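(* Let $T\subset\mathbb{R}^d$, let $I$ be a countable set, let $(a_j)_{j\in I}$ be real numbers with $\sum_{j\in I}|a_j|<\infty$, and put $A=\sum_{j\in I}a_j$. Let $U_j^{(n)}=U_j^{(n)}(t)$, $t\in T$, $j\in I$, $n=1,2,\dots$, be real-valued stochastic processes with bounded sample paths, and let $\psi^{(n)}=\psi^{(n)}(t)$, $t\in T$, $n=1,2,\dots$, be stochastic processes that admit the representation $$\psi^{(n)}=\sum_{j\in I}a_jU_j^{(n)} .$$ Assume that $$\sup_n\sup_{j\in I}\mathbb{E}\big(\|U_j^{(n)}\|_T\big)<\infty$$ and that for each pair $i,j\in I$, $$\|U_i^{(n)}-U_j^{(n)}\|_T\to 0\quad\text{in probability as } n\to\infty .$$ Fix $e\in I$. Then $$\|\psi^{(n)}-A\,U_e^{(n)}\|_T\to 0\quad\text{in probability as } n\to\infty .$$ Moreover, if for a certain $p\geq 1$ we have $\sup_n\sup_{j\in I}\mathbb{E}(\|U_j^{(n)}\|_T^p)<\infty$ and, for each pair $i,j\in I$, $\mathbb{E}(\|U_i^{(n)}-U_j^{(n)}\|_T^p)\to0$ as $n\to\infty$, then $$\mathbb{E}\big(\|\psi^{(n)}-A\,U_e^{(n)}\|_T^p\big)\to 0\quad\text{as } n\to\infty .$$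
   Context: For a bounded function $x$ on $T$, $\|x\|_T=\sup_{t\in T}|x(t)|$. For each $n$, all processes $\psi^{(n)}$ and $U_j^{(n)}$, $j\in I$, are defined on a common probability space, and the suprema $\|\cdot\|_T$ appearing are random variables (measurable). *)

theory Defs
  imports "HOL-Probability.Probability"
begin

(* Valued in ennreal: the norm of an unbounded function is \<infinity>, and the norm over the
   empty set is 0 (with a real-valued SUP both would be unspecified values). *)
definition sup_norm :: "'t set \<Rightarrow> ('t \<Rightarrow> real) \<Rightarrow> ennreal" where
  "sup_norm T x = (SUP t\<in>T. ennreal \<bar>x t\<bar>)"

(* x powr p on [0, \<infinity>] for exponents p > 0; the library has powr only for finite arguments. *)
definition ennreal_powr :: "ennreal \<Rightarrow> real \<Rightarrow> ennreal" where
  "ennreal_powr x p = (if x = \<infinity> then \<infinity> else ennreal (enn2real x powr p))"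

(* The n-th variable lives on its own probability space M n. *)
definition tendsto_zero_in_prob :: "(nat \<Rightarrow> 'w measure) \<Rightarrow> (nat \<Rightarrow> 'w \<Rightarrow> ennreal) \<Rightarrow> bool" where
  "tendsto_zero_in_prob M X \<longleftrightarrow>
     (\<forall>\<epsilon>>0. (\<lambda>n. measure (M n) {\<omega> \<in> space (M n). X n \<omega> > ennreal \<epsilon>}) \<longlonglongrightarrow> 0)"

end

theory Submission
  imports Defs
begin

text \<open>
  Put \<open>D n j = \<parallel>U n j - U n e\<parallel>\<close>, the norm being the supremum over \<open>T\<close>. Since
  \<open>A\<close> is the sum of the coefficients, \<open>\<psi> n - A * U n e\<close> is the series of the terms
  \<open>a j * (U n j - U n e)\<close>, so its norm \<open>S n\<close> satisfies
  \<open>S n \<le> (\<Sum>j\<in>I. \<bar>a j\<bar> * D n j)\<close> almost surely (lemma \<open>sup_norm_centred_series_le\<close>).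
  Both claims follow from this single inequality by the same scheme: bound a suitable mean of
  \<open>S n\<close> by a series over \<open>j\<close> each of whose terms tends to \<open>0\<close> as \<open>n\<close> grows and is at most
  a constant times \<open>\<bar>a j\<bar>\<close>, uniformly in \<open>n\<close>; dominated convergence on the index set then
  finishes (lemma \<open>tendsto_zero_dominated_series\<close>).

  For convergence in probability the mean is that of \<open>min (S n) 1\<close>, which metrises
  this convergence (lemmas \<open>tendsto_zero_in_prob_imp_truncated_mean\<close> and
  \<open>truncated_mean_imp_tendsto_zero_in_prob\<close>). Truncation at \<open>1\<close> is countably subadditive,
  so the series has the terms \<open>E (min (\<bar>a j\<bar> * D n j) 1)\<close>, and the bound on the first
  moments dominates them.

  For convergence of \<open>p\<close>-th moments, convexity of the power function
  (lemma \<open>powr_mean_le_mean_powr\<close>) bounds \<open>(S n)\<close> to the power \<open>p\<close> by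
  a constant times the series of \<open>\<bar>a j\<bar>\<close> times the \<open>p\<close>-th power of \<open>D n j\<close>. The expectations of
  these powers are bounded uniformly in \<open>n\<close> and \<open>j\<close> and tend to \<open>0\<close> for each \<open>j\<close>.

  Series over \<open>I\<close> are written as integrals against counting measure, with values in
  \<open>[0, \<infinity>]\<close>, so that Tonelli's theorem and dominated convergence apply to them.
\<close>

section \<open>Nonnegative extended reals\<close>

lemma ennreal_tendsto_zeroI:
  fixes x :: "nat \<Rightarrow> ennreal"
  assumes "\<And>\<epsilon>::real. \<epsilon> > 0 \<Longrightarrow> eventually (\<lambda>n. x n \<le> ennreal \<epsilon>) sequentially"
  shows "x \<longlonglongrightarrow> 0"
proof (rule order_tendstoI)
  fix b :: ennreal assume "0 < b"
  then obtain c where c: "0 < c" "c < b" using dense by blast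
  then obtain \<epsilon> where \<epsilon>: "c = ennreal \<epsilon>" "\<epsilon> > 0"
    by (cases c) auto
  have "eventually (\<lambda>n. x n \<le> ennreal \<epsilon>) sequentially" using assms \<epsilon> by blast
  then show "eventually (\<lambda>n. x n < b) sequentially"
    by eventually_elim (use c \<epsilon> in auto)
qed simp

lemma ennreal_tendsto_zero_if_le:
  fixes x y :: "nat \<Rightarrow> ennreal"
  assumes "y \<longlonglongrightarrow> 0" and "\<And>n. x n \<le> y n"
  shows "x \<longlonglongrightarrow> 0"
  by (rule tendsto_sandwich[OF _ _ tendsto_const assms(1)]) (simp_all add: assms(2))

lemma ennreal_top_if_unbounded:
  assumes "\<And>r::real. r > 0 \<Longrightarrow> ennreal r \<le> y"
  shows "y = \<top>"
proof (cases y)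
  case (real q)
  then show ?thesis using assms[of "q + 1"] by simp
qed

section \<open>Series and supremum norms\<close>

text \<open>
  Each finite partial sum obeys the triangle inequality and is bounded by the full integral;
  the bound passes to the limit.
\<close>

lemma has_sum_norm_le_nn_integral:
  fixes f :: "'i \<Rightarrow> real"
  assumes "(f has_sum s) I"
  shows "ennreal \<bar>s\<bar> \<le> (\<integral>\<^sup>+j. ennreal \<bar>f j\<bar> \<partial>count_space I)"
proof (rule tendsto_upperbound)
  show "((\<lambda>F. ennreal \<bar>sum f F\<bar>) \<longlongrightarrow> ennreal \<bar>s\<bar>) (finite_subsets_at_top I)"
    using assms unfolding has_sum_def by (intro tendsto_ennrealI tendsto_rabs)
  have "ennreal \<bar>sum f F\<bar> \<le> (\<integral>\<^sup>+j. ennreal \<bar>f j\<bar> \<partial>count_space I)"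
    if F: "finite F" "F \<subseteq> I" for F
  proof -
    have "ennreal \<bar>sum f F\<bar> \<le> (\<Sum>j\<in>F. ennreal \<bar>f j\<bar>)"
      by (simp add: sum_abs ennreal_leI)
    also have "\<dots> = (\<integral>\<^sup>+j. ennreal \<bar>f j\<bar> \<partial>count_space F)"
      using F by (simp add: nn_integral_count_space_finite)
    also have "\<dots> \<le> (\<integral>\<^sup>+j. ennreal \<bar>f j\<bar> \<partial>count_space I)"
      using F by (auto simp: nn_integral_count_space_indicator intro!: nn_integral_mono split: split_indicator)
    finally show ?thesis .
  qed
  then show "eventually (\<lambda>F. ennreal \<bar>sum f F\<bar> \<le> (\<integral>\<^sup>+j. ennreal \<bar>f j\<bar> \<partial>count_space I))
      (finite_subsets_at_top I)"
    by (intro eventually_finite_subsets_at_top_weakI) auto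
qed simp

lemma abs_summable_nn_integral_finite:
  fixes a :: "'i \<Rightarrow> real"
  assumes "(\<lambda>j. \<bar>a j\<bar>) summable_on I"
  shows "(\<integral>\<^sup>+j. ennreal \<bar>a j\<bar> \<partial>count_space I) < \<infinity>"
proof -
  have "Infinite_Set_Sum.abs_summable_on a I"
    using assms by (simp flip: abs_summable_equivalent)
  then show ?thesis
    unfolding Infinite_Set_Sum.abs_summable_on_def integrable_iff_bounded by simp
qed

lemma sup_norm_diff_le: "sup_norm T (\<lambda>t. x t - y t) \<le> sup_norm T x + sup_norm T y"
  unfolding sup_norm_def
proof (rule SUP_least)
  fix t assume t: "t \<in> T"
  have "ennreal \<bar>x t - y t\<bar> \<le> ennreal \<bar>x t\<bar> + ennreal \<bar>y t\<bar>"
    by (simp flip: ennreal_plus add: ennreal_leI)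
  also have "\<dots> \<le> (SUP t\<in>T. ennreal \<bar>x t\<bar>) + (SUP t\<in>T. ennreal \<bar>y t\<bar>)"
    using t by (intro add_mono SUP_upper)
  finally show "ennreal \<bar>x t - y t\<bar> \<le> \<dots>" .
qed

text \<open>
  Centring: the sum of the coefficients times \<open>v t\<close> is subtracted term by term, at each \<open>t\<close>
  separately. Bounding every difference by its norm makes the result independent of \<open>t\<close>.
\<close>

lemma sup_norm_centred_series_le:
  assumes sums: "\<And>t. t \<in> T \<Longrightarrow> ((\<lambda>j. a j * u j t) has_sum s t) I"
    and A: "(a has_sum A) I"
  shows "sup_norm T (\<lambda>t. s t - A * v t)
    \<le> (\<integral>\<^sup>+j. ennreal \<bar>a j\<bar> * sup_norm T (\<lambda>t. u j t - v t) \<partial>count_space I)"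
  unfolding sup_norm_def[of _ "\<lambda>t. s t - _ t"]
proof (rule SUP_least)
  fix t assume t: "t \<in> T"
  have "((\<lambda>j. a j * u j t + - (a j * v t)) has_sum s t + - (A * v t)) I"
    using has_sum_cmult_left[OF A, of "v t"] sums[OF t]
    by (intro has_sum_add) (auto intro: has_sum_uminusI)
  then have "((\<lambda>j. a j * (u j t - v t)) has_sum s t - A * v t) I"
    by (simp add: algebra_simps)
  from has_sum_norm_le_nn_integral[OF this]
  have "ennreal \<bar>s t - A * v t\<bar> \<le> (\<integral>\<^sup>+j. ennreal \<bar>a j\<bar> * ennreal \<bar>u j t - v t\<bar> \<partial>count_space I)"
    by (simp add: abs_mult ennreal_mult)
  also have "\<dots> \<le> (\<integral>\<^sup>+j. ennreal \<bar>a j\<bar> * sup_norm T (\<lambda>t. u j t - v t) \<partial>count_space I)"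
    unfolding sup_norm_def by (intro nn_integral_mono mult_left_mono SUP_upper2[OF t]) auto
  finally show "ennreal \<bar>s t - A * v t\<bar> \<le> \<dots>" .
qed

section \<open>Powers and convexity\<close>

lemma ennreal_powr_ennreal [simp]: "0 \<le> x \<Longrightarrow> ennreal_powr (ennreal x) p = ennreal (x powr p)"
  by (simp add: ennreal_powr_def)

lemma ennreal_powr_top [simp]: "ennreal_powr top p = top"
  by (simp add: ennreal_powr_def)

lemma ennreal_powr_measurable [measurable]:
  assumes [measurable]: "f \<in> borel_measurable M"
  shows "(\<lambda>x. ennreal_powr (f x) p) \<in> borel_measurable M"
  unfolding ennreal_powr_def by measurable

lemma ennreal_powr_mono:
  assumes "p \<ge> 0" "x \<le> y"
  shows "ennreal_powr x p \<le> ennreal_powr y p"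
  using assms by (cases x; cases y) (auto simp: top_unique powr_mono2)

text \<open>
  A sum is at most twice the larger summand. The constant is not the best one, but only
  finiteness of the moments of a difference matters.
\<close>

lemma ennreal_powr_add_le:
  assumes "p \<ge> 0"
  shows "ennreal_powr (x + y) p \<le> ennreal (2 powr p) * (ennreal_powr x p + ennreal_powr y p)"
proof (cases x; cases y)
  fix r q assume *: "x = ennreal r" "0 \<le> r" "y = ennreal q" "0 \<le> q"
  have "(r + q) powr p \<le> (2 * max r q) powr p"
    using * assms by (intro powr_mono2) auto
  also have "\<dots> = 2 powr p * max r q powr p"
    using * by (simp add: powr_mult)
  also have "\<dots> \<le> 2 powr p * (r powr p + q powr p)"
    by (intro mult_left_mono) (auto simp: max_def)
  finally show ?thesis
    using * by (simp flip: ennreal_plus ennreal_mult add: ennreal_leI)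
qed (auto simp: ennreal_mult_top)

text \<open>
  The graph of the function \<open>x powr p\<close> lies above its tangent at \<open>m\<close>. The negative part of the
  tangent is moved to the other side, so that the inequality involves no subtraction and
  can be integrated in \<open>[0, \<infinity>]\<close>.
\<close>

lemma Young_tangent:
  fixes x m p :: real
  assumes "p \<ge> 1" "x \<ge> 0" "m > 0"
  shows "p * m powr (p - 1) * x \<le> x powr p + (p - 1) * m powr p"
proof (cases "x = 0")
  case False
  have "(x powr p) powr (1/p) * (m powr p) powr (1 - 1/p) \<le> 1/p * x powr p + (1 - 1/p) * m powr p"
    using assms False by (intro Youngs_inequality_0) auto
  moreover have "p * (1 - 1/p) = p - 1" using assms by (simp add: field_simps)
  ultimately have "x * m powr (p - 1) \<le> 1/p * x powr p + (1 - 1/p) * m powr p"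
    using assms by (simp add: powr_powr)
  then have "p * (x * m powr (p - 1)) \<le> p * (1/p * x powr p + (1 - 1/p) * m powr p)"
    using assms by (intro mult_left_mono) auto
  also have "\<dots> = x powr p + (p - 1) * m powr p"
    using assms by (simp add: field_simps)
  finally show ?thesis by (simp add: mult_ac)
qed (use assms in simp)

text \<open>
  Jensen's inequality for the weights \<open>w\<close>, whose total mass is at most \<open>B\<close>: integrate the
  tangent inequality at the point \<open>m = s / B\<close>, where \<open>s\<close> is any real number
  with \<open>0 < s \<le> S\<close>. Because \<open>m\<close> is always finite, the term for \<open>m\<close> can be cancelled even if the
  mean is infinite. An infinite \<open>S\<close> is reached through arbitrarily large \<open>s\<close>.
\<close>

lemma powr_mean_le_mean_powr:
  assumes p: "p \<ge> 1" and B: "B > 0"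
    and w [measurable]: "w \<in> borel_measurable N" and f [measurable]: "f \<in> borel_measurable N"
    and mass: "(\<integral>\<^sup>+j. w j \<partial>N) \<le> ennreal B"
    and S: "S \<le> (\<integral>\<^sup>+j. w j * f j \<partial>N)"
  shows "ennreal_powr S p \<le> ennreal (B powr (p - 1)) * (\<integral>\<^sup>+j. w j * ennreal_powr (f j) p \<partial>N)"
    (is "_ \<le> _ * ?X")
proof -
  have real_case: "ennreal (s powr p) \<le> ennreal (B powr (p - 1)) * ?X"
    if s: "s > 0" "ennreal s \<le> S" for s
  proof (cases ?X)
    case (real X)
    define m where "m = s / B"
    have m: "m > 0" using s B by (simp add: m_def)
    have pt: "ennreal (p * m powr (p - 1)) * y \<le> ennreal_powr y p + ennreal ((p - 1) * m powr p)" for y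
    proof (cases y)
      case (real r)
      then show ?thesis
        using Young_tangent[OF p, of r m] m p by (simp flip: ennreal_plus ennreal_mult add: ennreal_leI)
    qed simp
    have "ennreal (p * m powr (p - 1)) * ennreal s
        \<le> ennreal (p * m powr (p - 1)) * (\<integral>\<^sup>+j. w j * f j \<partial>N)"
      using s S by (intro mult_left_mono) auto
    also have "\<dots> = (\<integral>\<^sup>+j. w j * (ennreal (p * m powr (p - 1)) * f j) \<partial>N)"
      by (subst nn_integral_cmult[symmetric]) (auto simp: mult_ac)
    also have "\<dots> \<le> (\<integral>\<^sup>+j. w j * (ennreal_powr (f j) p + ennreal ((p - 1) * m powr p)) \<partial>N)"
      by (intro nn_integral_mono mult_left_mono pt) auto
    also have "\<dots> = ?X + (\<integral>\<^sup>+j. w j \<partial>N) * ennreal ((p - 1) * m powr p)"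
      by (simp add: distrib_left nn_integral_add nn_integral_multc)
    also have "\<dots> \<le> ?X + ennreal B * ennreal ((p - 1) * m powr p)"
      by (intro add_left_mono mult_right_mono mass) auto
    finally have "ennreal (p * m powr (p - 1) * s) \<le> ennreal (X + B * ((p - 1) * m powr p))"
      using real s B p m by (simp flip: ennreal_plus ennreal_mult)
    then have "p * m powr (p - 1) * s \<le> X + B * ((p - 1) * m powr p)"
      using real B p by (subst (asm) ennreal_le_iff) auto
    moreover have "m powr (p - 1) * s = B * m powr p"
      using powr_add[of m "p - 1" 1] s B by (simp add: m_def)
    ultimately have "B * m powr p \<le> X"
      by (simp add: algebra_simps)
    moreover have "B powr (p - 1) * (B * m powr p) = s powr p"
      using B s by (simp add: m_def powr_divide powr_diff)
    ultimately have "s powr p \<le> B powr (p - 1) * X"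
      by (metis mult_left_mono powr_ge_zero)
    then show ?thesis
      using real by (simp flip: ennreal_mult add: ennreal_leI)
  qed (use B in \<open>simp add: ennreal_mult_top\<close>)
  show ?thesis
  proof (cases S)
    case (real s)
    then show ?thesis using real_case[of s] by (cases "s = 0") (auto simp: ennreal_powr_def)
  next
    case top
    have "ennreal r \<le> ennreal (B powr (p - 1)) * ?X" if "r > 0" for r
      using real_case[of "r powr (1/p)"] that top p by (simp add: powr_powr)
    then have "ennreal (B powr (p - 1)) * ?X = top"
      by (intro ennreal_top_if_unbounded)
    then show ?thesis by simp
  qed
qed

section \<open>Convergence in probability through truncated means\<close>

lemma tendsto_zero_in_prob_imp_truncated_mean:
  assumes prob: "\<And>n. prob_space (M n)"
    and X [measurable]: "\<And>n. X n \<in> borel_measurable (M n)"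
    and lim: "tendsto_zero_in_prob M X" and c: "c \<ge> 0"
  shows "(\<lambda>n. \<integral>\<^sup>+\<omega>. min (ennreal c * X n \<omega>) 1 \<partial>M n) \<longlonglongrightarrow> 0"
proof (rule ennreal_tendsto_zeroI)
  fix \<epsilon> :: real assume \<epsilon>: "\<epsilon> > 0"
  \<comment> \<open>Dividing by \<open>c + 1\<close> instead of \<open>c\<close> allows \<open>c = 0\<close>.\<close>
  define \<delta> where "\<delta> = \<epsilon> / (2 * (c + 1))"
  have \<delta>: "\<delta> > 0" "c * \<delta> \<le> \<epsilon> / 2"
    using \<epsilon> c by (auto simp: \<delta>_def field_simps)
  have bound: "(\<integral>\<^sup>+\<omega>. min (ennreal c * X n \<omega>) 1 \<partial>M n)
      \<le> ennreal (\<epsilon>/2) + ennreal (measure (M n) {\<omega> \<in> space (M n). X n \<omega> > ennreal \<delta>})" for n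
  proof -
    interpret prob_space "M n" by (rule prob)
    let ?E = "{\<omega> \<in> space (M n). X n \<omega> > ennreal \<delta>}"
    have "(\<integral>\<^sup>+\<omega>. min (ennreal c * X n \<omega>) 1 \<partial>M n) \<le> (\<integral>\<^sup>+\<omega>. ennreal (\<epsilon>/2) + indicator ?E \<omega> \<partial>M n)"
    proof (rule nn_integral_mono)
      fix \<omega> assume \<omega>: "\<omega> \<in> space (M n)"
      show "min (ennreal c * X n \<omega>) 1 \<le> ennreal (\<epsilon>/2) + indicator ?E \<omega>"
      proof (cases "X n \<omega> > ennreal \<delta>")
        case False
        then have "ennreal c * X n \<omega> \<le> ennreal c * ennreal \<delta>"
          by (intro mult_left_mono) auto
        also have "\<dots> \<le> ennreal (\<epsilon>/2)"
          using c \<delta> by (simp flip: ennreal_mult add: ennreal_leI)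
        finally show ?thesis using False by (simp add: min.coboundedI1)
      qed (use \<omega> in \<open>simp add: min.coboundedI2 add_increasing\<close>)
    qed
    also have "\<dots> = ennreal (\<epsilon>/2) + emeasure (M n) ?E"
      by (simp add: nn_integral_add emeasure_space_1)
    finally show ?thesis by (simp add: emeasure_eq_measure)
  qed
  have "(\<lambda>n. measure (M n) {\<omega> \<in> space (M n). X n \<omega> > ennreal \<delta>}) \<longlonglongrightarrow> 0"
    using lim \<delta> unfolding tendsto_zero_in_prob_def by blast
  then have "eventually (\<lambda>n. measure (M n) {\<omega> \<in> space (M n). X n \<omega> > ennreal \<delta>} < \<epsilon>/2) sequentially"
    by (rule order_tendstoD) (use \<epsilon> in simp)
  then show "eventually (\<lambda>n. (\<integral>\<^sup>+\<omega>. min (ennreal c * X n \<omega>) 1 \<partial>M n) \<le> ennreal \<epsilon>) sequentially"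
  proof eventually_elim
    case (elim n)
    note bound[of n]
    also have "ennreal (\<epsilon>/2) + ennreal (measure (M n) {\<omega> \<in> space (M n). X n \<omega> > ennreal \<delta>})
        \<le> ennreal (\<epsilon>/2) + ennreal (\<epsilon>/2)"
      using elim by (intro add_left_mono ennreal_leI) simp
    also have "\<dots> = ennreal \<epsilon>" using \<epsilon> by (simp flip: ennreal_plus)
    finally show ?case .
  qed
qed

text \<open>
  Markov's inequality for the truncated variable: where \<open>X > \<epsilon>\<close>, the truncation is at least
  \<open>min \<epsilon> 1\<close>.
\<close>

lemma truncated_mean_imp_tendsto_zero_in_prob:
  assumes prob: "\<And>n. prob_space (M n)"
    and X [measurable]: "\<And>n. X n \<in> borel_measurable (M n)"
    and lim: "(\<lambda>n. \<integral>\<^sup>+\<omega>. min (X n \<omega>) 1 \<partial>M n) \<longlonglongrightarrow> 0"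
  shows "tendsto_zero_in_prob M X"
  unfolding tendsto_zero_in_prob_def
proof (intro allI impI)
  fix \<epsilon> :: real assume \<epsilon>: "\<epsilon> > 0"
  let ?E = "\<lambda>n. {\<omega> \<in> space (M n). X n \<omega> > ennreal \<epsilon>}"
  define c where "c = 1 / min \<epsilon> 1"
  have c: "c \<ge> 1" "c * \<epsilon> \<ge> 1" using \<epsilon> by (auto simp: c_def field_simps min_def)
  have bound: "ennreal (measure (M n) (?E n)) \<le> ennreal c * (\<integral>\<^sup>+\<omega>. min (X n \<omega>) 1 \<partial>M n)" for n
  proof -
    interpret prob_space "M n" by (rule prob)
    have "emeasure (M n) (?E n) = (\<integral>\<^sup>+\<omega>. indicator (?E n) \<omega> \<partial>M n)" by simp
    also have "\<dots> \<le> (\<integral>\<^sup>+\<omega>. ennreal c * min (X n \<omega>) 1 \<partial>M n)"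
    proof (rule nn_integral_mono)
      fix \<omega>
      have "1 \<le> ennreal c * min (X n \<omega>) 1" if "X n \<omega> > ennreal \<epsilon>"
      proof -
        have "1 \<le> ennreal (c * min \<epsilon> 1)" using c by (auto simp: min_def)
        also have "\<dots> = ennreal c * min (ennreal \<epsilon>) 1"
          using c \<epsilon> by (simp add: ennreal_mult min_def)
        also have "\<dots> \<le> ennreal c * min (X n \<omega>) 1"
          using that by (intro mult_left_mono min.mono) auto
        finally show ?thesis .
      qed
      then show "indicator (?E n) \<omega> \<le> ennreal c * min (X n \<omega>) 1"
        by (auto split: split_indicator)
    qed
    also have "\<dots> = ennreal c * (\<integral>\<^sup>+\<omega>. min (X n \<omega>) 1 \<partial>M n)"
      by (simp add: nn_integral_cmult)
    finally show ?thesis by (simp add: emeasure_eq_measure)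
  qed
  have "(\<lambda>n. ennreal c * (\<integral>\<^sup>+\<omega>. min (X n \<omega>) 1 \<partial>M n)) \<longlonglongrightarrow> ennreal c * 0"
    by (intro ennreal_tendsto_cmult lim) simp
  then have "(\<lambda>n. ennreal (measure (M n) (?E n))) \<longlonglongrightarrow> ennreal 0"
    unfolding mult_zero_right ennreal_0 by (rule ennreal_tendsto_zero_if_le) (rule bound)
  then show "(\<lambda>n. measure (M n) (?E n)) \<longlonglongrightarrow> 0"
    by (subst (asm) tendsto_ennreal_iff) auto
qed

text \<open>
  If some term exceeds \<open>1\<close>, its truncation alone already gives \<open>1\<close>; otherwise truncating the
  terms changes nothing.
\<close>

lemma min_one_nn_integral_le:
  fixes f :: "'i \<Rightarrow> ennreal"
  shows "min (\<integral>\<^sup>+j. f j \<partial>count_space I) 1 \<le> (\<integral>\<^sup>+j. min (f j) 1 \<partial>count_space I)"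
proof (cases "\<exists>i\<in>I. f i > 1")
  case True
  then obtain i where i: "i \<in> I" "f i > 1" by blast
  have "1 = (\<integral>\<^sup>+j. indicator {i} j \<partial>count_space I)"
    using i by simp
  also have "\<dots> \<le> (\<integral>\<^sup>+j. min (f j) 1 \<partial>count_space I)"
    using i by (intro nn_integral_mono) (auto split: split_indicator)
  finally show ?thesis by (rule min.coboundedI2)
next
  case False
  then have "(\<integral>\<^sup>+j. f j \<partial>count_space I) = (\<integral>\<^sup>+j. min (f j) 1 \<partial>count_space I)"
    by (intro nn_integral_cong) (auto simp: min_def)
  then show ?thesis by simp
qed

section \<open>The limit theorem\<close>

lemma tendsto_zero_dominated_series:
  fixes x :: "nat \<Rightarrow> 'i \<Rightarrow> ennreal"
  assumes a: "(\<lambda>j. \<bar>a j\<bar>) summable_on I" and K: "K < \<infinity>"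
    and bound: "\<And>n j. j \<in> I \<Longrightarrow> x n j \<le> ennreal \<bar>a j :: real\<bar> * K"
    and lim: "\<And>j. j \<in> I \<Longrightarrow> (\<lambda>n. x n j) \<longlonglongrightarrow> 0"
  shows "(\<lambda>n. \<integral>\<^sup>+j. x n j \<partial>count_space I) \<longlonglongrightarrow> 0"
proof -
  have "(\<lambda>n. \<integral>\<^sup>+j. x n j \<partial>count_space I) \<longlonglongrightarrow> (\<integral>\<^sup>+j. 0 \<partial>count_space I)"
  proof (rule nn_integral_dominated_convergence)
    show "(\<integral>\<^sup>+j. ennreal \<bar>a j\<bar> * K \<partial>count_space I) < \<infinity>"
      using abs_summable_nn_integral_finite[OF a] K
      by (simp add: nn_integral_multc ennreal_mult_less_top)
  qed (auto simp: AE_count_space bound lim)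
  then show ?thesis by simp
qed


theorem lemma1:
  fixes T :: "(real ^ 'd) set"
    and I :: "'i set"
    and a :: "'i \<Rightarrow> real"
    and A :: real
    and M :: "nat \<Rightarrow> 'w measure"
    and U :: "nat \<Rightarrow> 'i \<Rightarrow> real ^ 'd \<Rightarrow> 'w \<Rightarrow> real"
    and \<psi> :: "nat \<Rightarrow> real ^ 'd \<Rightarrow> 'w \<Rightarrow> real"
    and e :: 'i
  assumes countable_I: "countable I"
    and summable_a: "(\<lambda>j. \<bar>a j\<bar>) summable_on I"
    and A_def: "A = (\<Sum>\<^sub>\<infinity>j\<in>I. a j)"
    and prob: "\<And>n. prob_space (M n)"
    and U_process: "\<And>n j t. j \<in> I \<Longrightarrow> t \<in> T \<Longrightarrow> U n j t \<in> borel_measurable (M n)"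
    and U_bounded: "\<And>n j \<omega>. j \<in> I \<Longrightarrow> \<omega> \<in> space (M n) \<Longrightarrow> bounded ((\<lambda>t. U n j t \<omega>) ` T)"
    and psi_process: "\<And>n t. t \<in> T \<Longrightarrow> \<psi> n t \<in> borel_measurable (M n)"
    and psi_repr: "\<And>n. AE \<omega> in M n. \<forall>t\<in>T. ((\<lambda>j. a j * U n j t \<omega>) has_sum \<psi> n t \<omega>) I"
    and norm_U_measurable:
      "\<And>n j. j \<in> I \<Longrightarrow> (\<lambda>\<omega>. sup_norm T (\<lambda>t. U n j t \<omega>)) \<in> borel_measurable (M n)"
    and norm_diff_measurable:
      "\<And>n i j. i \<in> I \<Longrightarrow> j \<in> I \<Longrightarrow>
         (\<lambda>\<omega>. sup_norm T (\<lambda>t. U n i t \<omega> - U n j t \<omega>)) \<in> borel_measurable (M n)"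
    and norm_psi_measurable:
      "\<And>n. (\<lambda>\<omega>. sup_norm T (\<lambda>t. \<psi> n t \<omega> - A * U n e t \<omega>)) \<in> borel_measurable (M n)"
    and moment_bound:
      "(SUP n. SUP j\<in>I. \<integral>\<^sup>+ \<omega>. sup_norm T (\<lambda>t. U n j t \<omega>) \<partial>M n) < \<infinity>"
    and diff_in_prob:
      "\<And>i j. i \<in> I \<Longrightarrow> j \<in> I \<Longrightarrow>
         tendsto_zero_in_prob M (\<lambda>n \<omega>. sup_norm T (\<lambda>t. U n i t \<omega> - U n j t \<omega>))"
    and e_in_I: "e \<in> I"
  shows "tendsto_zero_in_prob M (\<lambda>n \<omega>. sup_norm T (\<lambda>t. \<psi> n t \<omega> - A * U n e t \<omega>)) \<and>
    (\<forall>p::real. p \<ge> 1 \<longrightarrow>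
       (SUP n. SUP j\<in>I. \<integral>\<^sup>+ \<omega>. ennreal_powr (sup_norm T (\<lambda>t. U n j t \<omega>)) p \<partial>M n) < \<infinity> \<longrightarrow>
       (\<forall>i\<in>I. \<forall>j\<in>I.
          (\<lambda>n. \<integral>\<^sup>+ \<omega>. ennreal_powr (sup_norm T (\<lambda>t. U n i t \<omega> - U n j t \<omega>)) p \<partial>M n) \<longlonglongrightarrow> 0) \<longrightarrow>
       (\<lambda>n. \<integral>\<^sup>+ \<omega>. ennreal_powr (sup_norm T (\<lambda>t. \<psi> n t \<omega> - A * U n e t \<omega>)) p \<partial>M n) \<longlonglongrightarrow> 0)"


proof (intro conjI allI impI)
  define D where "D n j \<omega> = sup_norm T (\<lambda>t. U n j t \<omega> - U n e t \<omega>)" for n j \<omega>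
  define S where "S n \<omega> = sup_norm T (\<lambda>t. \<psi> n t \<omega> - A * U n e t \<omega>)" for n \<omega>
  have D_meas [measurable]: "D n j \<in> borel_measurable (M n)" if "j \<in> I" for n j
    using norm_diff_measurable[OF that e_in_I] unfolding D_def .
  have S_meas [measurable]: "S n \<in> borel_measurable (M n)" for n
    using norm_psi_measurable unfolding S_def .
  note [measurable] = norm_U_measurable norm_U_measurable[OF e_in_I]
  have D_le: "D n j \<omega> \<le> sup_norm T (\<lambda>t. U n j t \<omega>) + sup_norm T (\<lambda>t. U n e t \<omega>)" for n j \<omega>
    unfolding D_def by (rule sup_norm_diff_le)
  have a_sum: "(a has_sum A) I"
    unfolding A_def using summable_a abs_summable_summable[of a I]
    by (intro has_sum_infsum) simp
  have S_le: "AE \<omega> in M n. S n \<omega> \<le> (\<integral>\<^sup>+j. ennreal \<bar>a j\<bar> * D n j \<omega> \<partial>count_space I)" for n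
    using psi_repr[of n] unfolding S_def D_def
    by eventually_elim (use a_sum in \<open>auto intro!: sup_norm_centred_series_le\<close>)

  show "tendsto_zero_in_prob M (\<lambda>n \<omega>. sup_norm T (\<lambda>t. \<psi> n t \<omega> - A * U n e t \<omega>))"
    unfolding S_def[symmetric]
  proof (rule truncated_mean_imp_tendsto_zero_in_prob[OF prob S_meas])
    define C where "C = (SUP n. SUP j\<in>I. \<integral>\<^sup>+ \<omega>. sup_norm T (\<lambda>t. U n j t \<omega>) \<partial>M n)"
    have U_mean: "(\<integral>\<^sup>+ \<omega>. sup_norm T (\<lambda>t. U n j t \<omega>) \<partial>M n) \<le> C" if "j \<in> I" for n j
      unfolding C_def using that by (intro SUP_upper2[of n] SUP_upper2[of j]) auto
    have D_mean: "(\<integral>\<^sup>+\<omega>. D n j \<omega> \<partial>M n) \<le> C + C" if j: "j \<in> I" for n j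
    proof -
      have "(\<integral>\<^sup>+\<omega>. D n j \<omega> \<partial>M n)
          \<le> (\<integral>\<^sup>+\<omega>. sup_norm T (\<lambda>t. U n j t \<omega>) + sup_norm T (\<lambda>t. U n e t \<omega>) \<partial>M n)"
        by (intro nn_integral_mono D_le)
      also have "\<dots> \<le> C + C"
        using j by (subst nn_integral_add) (auto intro!: add_mono U_mean e_in_I)
      finally show ?thesis .
    qed
    let ?x = "\<lambda>n j. \<integral>\<^sup>+\<omega>. min (ennreal \<bar>a j\<bar> * D n j \<omega>) 1 \<partial>M n"
    have x_lim: "(\<lambda>n. \<integral>\<^sup>+j. ?x n j \<partial>count_space I) \<longlonglongrightarrow> 0"
    proof (rule tendsto_zero_dominated_series[OF summable_a])
      show "C + C < \<infinity>" using moment_bound unfolding C_def[symmetric] by simp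
    next
      fix n j assume j: "j \<in> I"
      have "?x n j \<le> (\<integral>\<^sup>+\<omega>. ennreal \<bar>a j\<bar> * D n j \<omega> \<partial>M n)"
        by (intro nn_integral_mono) simp
      also have "\<dots> \<le> ennreal \<bar>a j\<bar> * (C + C)"
        using j by (subst nn_integral_cmult) (auto intro!: mult_left_mono D_mean)
      finally show "?x n j \<le> ennreal \<bar>a j\<bar> * (C + C)" .
    next
      fix j assume j: "j \<in> I"
      show "(\<lambda>n. ?x n j) \<longlonglongrightarrow> 0"
        using diff_in_prob[OF j e_in_I] j
        by (intro tendsto_zero_in_prob_imp_truncated_mean prob) (auto simp: D_def[symmetric])
    qed
    have "(\<integral>\<^sup>+\<omega>. min (S n \<omega>) 1 \<partial>M n) \<le> (\<integral>\<^sup>+j. ?x n j \<partial>count_space I)" for n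
    proof -
      have "(\<integral>\<^sup>+\<omega>. min (S n \<omega>) 1 \<partial>M n)
          \<le> (\<integral>\<^sup>+\<omega>. (\<integral>\<^sup>+j. min (ennreal \<bar>a j\<bar> * D n j \<omega>) 1 \<partial>count_space I) \<partial>M n)"
      proof (rule nn_integral_mono_AE)
        show "AE \<omega> in M n. min (S n \<omega>) 1 \<le> (\<integral>\<^sup>+j. min (ennreal \<bar>a j\<bar> * D n j \<omega>) 1 \<partial>count_space I)"
          using S_le[of n]
        proof eventually_elim
          case (elim \<omega>)
          then have "min (S n \<omega>) 1 \<le> min (\<integral>\<^sup>+j. ennreal \<bar>a j\<bar> * D n j \<omega> \<partial>count_space I) 1"
            by (intro min.mono) auto
          also have "\<dots> \<le> (\<integral>\<^sup>+j. min (ennreal \<bar>a j\<bar> * D n j \<omega>) 1 \<partial>count_space I)"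
            by (rule min_one_nn_integral_le)
          finally show ?case .
        qed
      qed
      also have "\<dots> = (\<integral>\<^sup>+j. ?x n j \<partial>count_space I)"
        by (intro nn_integral_count_space_nn_integral countable_I) measurable
      finally show ?thesis .
    qed
    then show "(\<lambda>n. \<integral>\<^sup>+\<omega>. min (S n \<omega>) 1 \<partial>M n) \<longlonglongrightarrow> 0"
      by (rule ennreal_tendsto_zero_if_le[OF x_lim])
  qed

  fix p :: real
  assume p: "p \<ge> 1"
    and powr_bound: "(SUP n. SUP j\<in>I. \<integral>\<^sup>+ \<omega>. ennreal_powr (sup_norm T (\<lambda>t. U n j t \<omega>)) p \<partial>M n) < \<infinity>"
    and powr_lim: "\<forall>i\<in>I. \<forall>j\<in>I. (\<lambda>n. \<integral>\<^sup>+ \<omega>. ennreal_powr (sup_norm T (\<lambda>t. U n i t \<omega> - U n j t \<omega>)) p \<partial>M n) \<longlonglongrightarrow> 0"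
  define C where "C = (SUP n. SUP j\<in>I. \<integral>\<^sup>+ \<omega>. ennreal_powr (sup_norm T (\<lambda>t. U n j t \<omega>)) p \<partial>M n)"
  have U_mean: "(\<integral>\<^sup>+ \<omega>. ennreal_powr (sup_norm T (\<lambda>t. U n j t \<omega>)) p \<partial>M n) \<le> C" if "j \<in> I" for n j
    unfolding C_def using that by (intro SUP_upper2[of n] SUP_upper2[of j]) auto
  define K where "K = ennreal (2 powr p) * (C + C)"
  have K: "K < \<infinity>"
    using powr_bound unfolding C_def[symmetric] K_def by (simp add: ennreal_mult_less_top)
  have D_mean: "(\<integral>\<^sup>+\<omega>. ennreal_powr (D n j \<omega>) p \<partial>M n) \<le> K" if j: "j \<in> I" for n j
  proof -
    have "(\<integral>\<^sup>+\<omega>. ennreal_powr (D n j \<omega>) p \<partial>M n)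
        \<le> (\<integral>\<^sup>+\<omega>. ennreal (2 powr p) * (ennreal_powr (sup_norm T (\<lambda>t. U n j t \<omega>)) p
              + ennreal_powr (sup_norm T (\<lambda>t. U n e t \<omega>)) p) \<partial>M n)"
      using p by (intro nn_integral_mono order.trans[OF ennreal_powr_mono[OF _ D_le]
        ennreal_powr_add_le]) auto
    also have "\<dots> = ennreal (2 powr p) * ((\<integral>\<^sup>+\<omega>. ennreal_powr (sup_norm T (\<lambda>t. U n j t \<omega>)) p \<partial>M n)
              + (\<integral>\<^sup>+\<omega>. ennreal_powr (sup_norm T (\<lambda>t. U n e t \<omega>)) p \<partial>M n))"
      using j by (simp add: nn_integral_cmult nn_integral_add)
    also have "\<dots> \<le> K"
      unfolding K_def using j by (intro mult_left_mono add_mono U_mean e_in_I) auto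
    finally show ?thesis .
  qed
  \<comment> \<open>\<open>B\<close> is the total mass increased by \<open>1\<close>, to be positive even if all coefficients vanish.\<close>
  obtain B where B: "B > 0" "(\<integral>\<^sup>+j. ennreal \<bar>a j\<bar> \<partial>count_space I) \<le> ennreal B"
  proof (cases "\<integral>\<^sup>+j. ennreal \<bar>a j\<bar> \<partial>count_space I")
    case (real r)
    then show ?thesis by (intro that[of "r + 1"]) (auto intro: ennreal_leI)
  qed (use abs_summable_nn_integral_finite[OF summable_a] in simp)
  let ?x = "\<lambda>n j. ennreal \<bar>a j\<bar> * (\<integral>\<^sup>+\<omega>. ennreal_powr (D n j \<omega>) p \<partial>M n)"
  have x_lim: "(\<lambda>n. \<integral>\<^sup>+j. ?x n j \<partial>count_space I) \<longlonglongrightarrow> 0"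
  proof (rule tendsto_zero_dominated_series[OF summable_a K])
    fix n j assume "j \<in> I"
    then show "?x n j \<le> ennreal \<bar>a j\<bar> * K" by (intro mult_left_mono D_mean) auto
  next
    fix j assume j: "j \<in> I"
    have "(\<lambda>n. ?x n j) \<longlonglongrightarrow> ennreal \<bar>a j\<bar> * 0"
      using powr_lim j e_in_I unfolding D_def by (intro ennreal_tendsto_cmult) auto
    then show "(\<lambda>n. ?x n j) \<longlonglongrightarrow> 0" by simp
  qed
  have bound: "(\<integral>\<^sup>+\<omega>. ennreal_powr (S n \<omega>) p \<partial>M n)
      \<le> ennreal (B powr (p - 1)) * (\<integral>\<^sup>+j. ?x n j \<partial>count_space I)" for n
  proof -
    have "(\<integral>\<^sup>+\<omega>. ennreal_powr (S n \<omega>) p \<partial>M n) \<le> (\<integral>\<^sup>+\<omega>. ennreal (B powr (p - 1)) *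
        (\<integral>\<^sup>+j. ennreal \<bar>a j\<bar> * ennreal_powr (D n j \<omega>) p \<partial>count_space I) \<partial>M n)"
    proof (rule nn_integral_mono_AE)
      show "AE \<omega> in M n. ennreal_powr (S n \<omega>) p \<le> ennreal (B powr (p - 1)) *
          (\<integral>\<^sup>+j. ennreal \<bar>a j\<bar> * ennreal_powr (D n j \<omega>) p \<partial>count_space I)"
        using S_le[of n] by eventually_elim (intro powr_mean_le_mean_powr p B; simp)
    qed
    also have "\<dots> = (\<integral>\<^sup>+\<omega>. (\<integral>\<^sup>+j. ennreal (B powr (p - 1)) *
        (ennreal \<bar>a j\<bar> * ennreal_powr (D n j \<omega>) p) \<partial>count_space I) \<partial>M n)"
      by (simp add: nn_integral_cmult)
    also have "\<dots> = (\<integral>\<^sup>+j. (\<integral>\<^sup>+\<omega>. ennreal (B powr (p - 1)) *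
        (ennreal \<bar>a j\<bar> * ennreal_powr (D n j \<omega>) p) \<partial>M n) \<partial>count_space I)"
      by (intro nn_integral_count_space_nn_integral countable_I) measurable
    also have "\<dots> = (\<integral>\<^sup>+j. ennreal (B powr (p - 1)) * ?x n j \<partial>count_space I)"
      by (intro nn_integral_cong) (simp add: nn_integral_cmult)
    also have "\<dots> = ennreal (B powr (p - 1)) * (\<integral>\<^sup>+j. ?x n j \<partial>count_space I)"
      by (simp add: nn_integral_cmult)
    finally show ?thesis .
  qed
  have "(\<lambda>n. ennreal (B powr (p - 1)) * (\<integral>\<^sup>+j. ?x n j \<partial>count_space I))
      \<longlonglongrightarrow> ennreal (B powr (p - 1)) * 0"
    by (intro ennreal_tendsto_cmult x_lim) simp
  then have "(\<lambda>n. \<integral>\<^sup>+\<omega>. ennreal_powr (S n \<omega>) p \<partial>M n) \<longlonglongrightarrow> 0"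
    unfolding mult_zero_right by (rule ennreal_tendsto_zero_if_le) (rule bound)
  then show "(\<lambda>n. \<integral>\<^sup>+ \<omega>. ennreal_powr (sup_norm T (\<lambda>t. \<psi> n t \<omega> - A * U n e t \<omega>)) p \<partial>M n) \<longlonglongrightarrow> 0"
    unfolding S_def .
qed

end
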